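(* Let $s\in\mathbb{N}$ and let $(\boldsymbol{x}_n)_{n\ge 0}$ be a sequence in $[0,1)^s$ with uniform discrepancy $\widetilde{D}_N=\widetilde{D}_N((\boldsymbol{x}_n)_{n\ge 0})$. Let $f:\mathbb{N}_0\to\mathbb{R}$ be a non-decreasing function such that $N\widetilde{D}_N\le f(N)$ for all $N\in\mathbb{N}_0$. Let $g:\mathbb{N}_0\to\mathbb{N}_0$ be any function. Let $(N_j)_{j\ge 0}$ be a strictly increasing sequence in $\mathbb{N}$ with $N_0=1$ which is a divisibility chain, i.e. $N_j\mid N_{j+1}$ for all $j\ge 0$. For $A,j,k\in\mathbb{N}_0$ define $$G_{A,j}(k):=\#\{n\in\mathbb{N}_0 : AN_j\le n<(A+1)N_j,\ g(n)=k\}.$$ Then: (1) For every $N\in\mathbb{N}$ with $N_d\le N<N_{d+1}$ (for some $d\in\mathbb{N}_0$) we have $N D_N((\boldsymbol{x}_{g(n)})_{n\ge 0})\ge \max_{k\in\mathbb{N}_0} G_{0,d}(k)$. (2) Assume that for all $j\in\mathbb{N}_0$ and all $A\in\mathbb{N}_0$ the sequence $(G_{A,j}(k))_{k\in\mathbb{N}_0}$ is unimodal. Put $G_j:=\max_{k,A\in\mathbb{N}_0}G_{A,j}(k)$ for $j\in\mathbb{N}_0$. For $A,j\in\mathbb{N}_0$ let $v_{A,j}$ be the number of $k\in\mathbb{N}_0$ such that $g(n)=k$ for some $n$ with $AN_j\le n<(A+1)N_j$, and put $v_j:=\max_{A\in\mathbb{N}_0}v_{A,j}$. Then for every $N\in\mathbb{N}$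 with $N_d\le N<N_{d+1}$ we have $$N D_N((\boldsymbol{x}_{g(n)})_{n\ge 0})\le \sum_{j=0}^{d}\frac{N_{j+1}}{N_j}\,G_j\,f(v_j).$$
   Context: For a sequence $(\boldsymbol{y}_n)_{n\ge 0}$ in $[0,1)^s$ (repetitions of points allowed, counted with multiplicity) its discrepancy is $D_N((\boldsymbol{y}_n)_{n\ge0}):=\sup_{[\boldsymbol{a},\boldsymbol{b})\subseteq[0,1)^s}\left|\frac{\#\{n: 0\le n<N,\ \boldsymbol{y}_n\in[\boldsymbol{a},\boldsymbol{b})\}}{N}-\mathrm{vol}([\boldsymbol{a},\boldsymbol{b}))\right|$, the supremum over all subintervals $[\boldsymbol{a},\boldsymbol{b})$ of $[0,1)^s$; for a finite sequence the analogous definition is used. The uniform discrepancy is $\widetilde{D}_N((\boldsymbol{x}_n)_{n\ge0}):=\sup_{k\in\mathbb{N}_0}D_N((\boldsymbol{x}_{n+k})_{n\ge0})$. A sequence $(a_k)_{k\in\mathbb{N}_0}$ is called unimodal if the sequence $(a_{k+1}-a_k)_{k\in\mathbb{N}_0}$ has exactly one change of sign. $\mathbb{N}=\{1,2,\dots\}$, $\mathbb{N}_0=\mathbb{N}\cup\{0\}$. *)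

theory Defs
  imports "HOL-Analysis.Analysis"
begin

(* For vectors, x < y means x <= y and not y <= x, so {a..<b} is not the half-open
   box; here both inequalities are meant in every coordinate. *)
definition half_open_box :: "real ^ 's \<Rightarrow> real ^ 's \<Rightarrow> (real ^ 's) set" where
  "half_open_box a b = {y. \<forall>i. a $ i \<le> y $ i \<and> y $ i < b $ i}"

(* The family over which the supremum is taken is nonempty and bounded by 1. For N = 0
   the quotient is 0 by the convention on division; only N * discrepancy N y = 0 is
   relevant in that case. *)
definition discrepancy :: "nat \<Rightarrow> (nat \<Rightarrow> real ^ 's) \<Rightarrow> real" where
  "discrepancy N y =
     (SUP (a, b) \<in> {(a, b). half_open_box a b \<subseteq> half_open_box 0 1}.
        \<bar>real (card {n. n < N \<and> y n \<in> half_open_box a b}) / real N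
          - measure lborel (half_open_box a b)\<bar>)"

definition uniform_discrepancy :: "nat \<Rightarrow> (nat \<Rightarrow> real ^ 's) \<Rightarrow> real" where
  "uniform_discrepancy N x = (SUP k. discrepancy N (\<lambda>n. x (n + k)))"

(* A change of sign is a pair of nonzero terms of opposite sign with only zeros between
   them, i.e. zero terms are discarded before signs are compared. *)
definition sign_changes :: "(nat \<Rightarrow> real) \<Rightarrow> (nat \<times> nat) set" where
  "sign_changes d = {(i, j). i < j \<and> d i * d j < 0 \<and> (\<forall>l. i < l \<and> l < j \<longrightarrow> d l = 0)}"

definition unimodal :: "(nat \<Rightarrow> real) \<Rightarrow> bool" where
  "unimodal a \<longleftrightarrow> card (sign_changes (\<lambda>k. a (k + 1) - a k)) = 1"

definition hits :: "(nat \<Rightarrow> nat) \<Rightarrow> (nat \<Rightarrow> nat) \<Rightarrow> nat \<Rightarrow> nat \<Rightarrow> nat \<Rightarrow> nat" where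
  "hits Ns g A j k = card {n. A * Ns j \<le> n \<and> n < (A + 1) * Ns j \<and> g n = k}"

definition num_values :: "(nat \<Rightarrow> nat) \<Rightarrow> (nat \<Rightarrow> nat) \<Rightarrow> nat \<Rightarrow> nat \<Rightarrow> nat" where
  "num_values Ns g A j = card {k. \<exists>n. A * Ns j \<le> n \<and> n < (A + 1) * Ns j \<and> g n = k}"

(* The sets below are finite: hits and num_values at level j are at most Ns j. *)
definition max_hits :: "(nat \<Rightarrow> nat) \<Rightarrow> (nat \<Rightarrow> nat) \<Rightarrow> nat \<Rightarrow> nat" where
  "max_hits Ns g j = Max {hits Ns g A j k | A k. True}"

definition max_num_values :: "(nat \<Rightarrow> nat) \<Rightarrow> (nat \<Rightarrow> nat) \<Rightarrow> nat \<Rightarrow> nat" where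
  "max_num_values Ns g j = Max {num_values Ns g A j | A. True}"

end

(* Lower bound: a small box with corner x_k catches every n < N with g n = k, and its volume
   is arbitrarily small.

   Upper bound: fix a box B and put phi k = [x_k in B] - vol B, so that N times the local
   discrepancy is |sum_{n<N} phi (g n)|. Expanding N along the divisibility chain cuts [0, N)
   into fewer than N_{j+1}/N_j blocks of length N_j for each j <= d. On one block the sum
   is sum_k G(k) phi k, and summing over the superlevel sets {k. G(k) >= t} with
   1 <= t <= max G reduces it to sums of phi over sets which by unimodality are intervals of
   integers with at most v_j elements, each bounded by f(v_j). *)
theory Submission
  imports Defs
begin

section \<open>Sign changes of differences and unimodal functions of finite support\<close>

lemma ex_descent:
  fixes h :: "nat \<Rightarrow> real"
  assumes "i < j" "h j < h i"
  obtains p where "i \<le> p" "p < j" "h (p + 1) < h p"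
proof -
  have "\<exists>p. i \<le> p \<and> p < j \<and> h (p + 1) < h p"
  proof (rule ccontr)
    assume "\<not> ?thesis"
    then have no_descent: "\<And>p. i \<le> p \<Longrightarrow> p < j \<Longrightarrow> h p \<le> h (Suc p)"
      by (auto simp: not_less)
    have "i \<le> j" using assms by simp
    then have "j \<le> j \<longrightarrow> h i \<le> h j"
    proof (induction rule: dec_induct)
      case (step n)
      then show ?case using no_descent[of n] by auto
    qed auto
    then show False using assms by simp
  qed
  then show ?thesis using that by blast
qed

lemma ex_ascent:
  fixes h :: "nat \<Rightarrow> real"
  assumes "i < j" "h i < h j"
  obtains p where "i \<le> p" "p < j" "h p < h (p + 1)"
  using ex_descent[of i j "\<lambda>k. - h k"] assms by auto

text \<open>Take the last index before \<open>j\<close> with the sign of \<open>d i\<close>, then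
  the first later index of opposite sign: only zeros can lie between. The sign of
  \<open>d i'\<close> is recorded so that changes in opposite directions can be told apart.\<close>

lemma ex_sign_change:
  assumes "i < j" "d i * d j < 0"
  obtains i' j' where "(i', j') \<in> sign_changes d" "d i * d i' > 0"
proof -
  define i' where "i' = Max {l. l < j \<and> d i * d l > 0}"
  have fin: "finite {l. l < j \<and> d i * d l > 0}" by simp
  have "d i \<noteq> 0" using assms by auto
  then have "d i * d i > 0" by (metis not_real_square_gt_zero)
  then have "i \<in> {l. l < j \<and> d i * d l > 0}" using assms by simp
  then have i': "i' < j" "d i * d i' > 0"
    using Max_in[OF fin] unfolding i'_def by blast+
  have gt: "d i * d l \<le> 0" if "i' < l" "l < j" for l
    using Max_ge[OF fin, of l] that unfolding i'_def by fastforce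
  define j' where "j' = (LEAST l. i' < l \<and> d i * d l < 0)"
  have j': "i' < j'" "d i * d j' < 0"
    using LeastI[of "\<lambda>l. i' < l \<and> d i * d l < 0" j] assms i' unfolding j'_def by auto
  have "j' \<le> j"
    using Least_le[of "\<lambda>l. i' < l \<and> d i * d l < 0" j] assms i' unfolding j'_def by auto
  have "d l = 0" if "i' < l" "l < j'" for l
  proof -
    have "\<not> d i * d l < 0"
      using not_less_Least[of l "\<lambda>l. i' < l \<and> d i * d l < 0"] that unfolding j'_def by auto
    moreover have "d i * d l \<le> 0" using gt that \<open>j' \<le> j\<close> by simp
    ultimately show ?thesis using \<open>d i \<noteq> 0\<close> by auto
  qed
  moreover have "d i' * d j' < 0"
    using i' j' by (auto simp: zero_less_mult_iff mult_less_0_iff)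
  ultimately have "(i', j') \<in> sign_changes d"
    using j' unfolding sign_changes_def by auto
  then show ?thesis using that i' by blast
qed

text \<open>A valley would give a change of sign from \<open>-\<close> to \<open>+\<close>, and the return to zero of the
  finite support a second one from \<open>+\<close> to \<open>-\<close>.\<close>

lemma unimodal_no_valley:
  fixes h :: "nat \<Rightarrow> nat"
  assumes uni: "unimodal (\<lambda>k. real (h k))"
    and fin: "finite {k. h k \<noteq> 0}"
    and ij: "i < j" and jl: "j < l"
  shows "min (h i) (h l) \<le> h j"
proof (rule ccontr)
  assume "\<not> ?thesis"
  then have lt: "h j < h i" "h j < h l" by auto
  define d where "d k = real (h (k + 1)) - real (h k)" for k
  obtain p where p: "p < j" "h (p + 1) < h p"
    using ex_descent[OF ij, of "\<lambda>k. real (h k)"] lt by auto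
  obtain q where q: "j \<le> q" "q < l" "h q < h (q + 1)"
    using ex_ascent[OF jl, of "\<lambda>k. real (h k)"] lt by auto
  obtain M where M: "\<forall>k\<in>{k. h k \<noteq> 0}. k \<le> M"
    using fin finite_nat_set_iff_bounded_le by blast
  have "l < max l M + 1" by simp
  moreover have "h (max l M + 1) = 0" using M by force
  moreover from this lt have "h (max l M + 1) < h l" by simp
  ultimately obtain r where r: "l \<le> r" "h (r + 1) < h r"
    using ex_descent[of l "max l M + 1" "\<lambda>k. real (h k)"] by auto
  have sg: "d p < 0" "d q > 0" "d r < 0" using p q r unfolding d_def by auto
  then have "d p * d q < 0" "d q * d r < 0" by (auto simp: mult_less_0_iff)
  moreover have "p < q" "q < r" using p q r by auto
  ultimately obtain p1 p2 q1 q2 where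
    pq: "(p1, p2) \<in> sign_changes d" "d p * d p1 > 0" "(q1, q2) \<in> sign_changes d" "d q * d q1 > 0"
    using ex_sign_change[of p q d] ex_sign_change[of q r d] by metis
  have "card (sign_changes d) = 1" using uni unfolding unimodal_def d_def by simp
  \<comment> \<open>The change found from \<open>p\<close>, \<open>q\<close> starts at a negative
    difference, the one from \<open>q\<close>, \<open>r\<close> at a positive one, so they cannot
    coincide.\<close>
  then have "p1 = q1" using pq by (auto simp: card_1_singleton_iff)
  then show False using pq sg by (auto simp: zero_less_mult_iff)
qed

section \<open>Superlevel sets and weighted sums\<close>

text \<open>The half-open form covers the empty set and exposes the length, which is what bounds on
  window sums depend on.\<close>

lemma finite_convex_nat_set_interval:
  fixes S :: "nat set"
  assumes "finite S"
    and conv: "\<And>i j l. i \<in> S \<Longrightarrow> l \<in> S \<Longrightarrow> i < j \<Longrightarrow> j < l \<Longrightarrow> j \<in> S"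
  shows "\<exists>a. S = {a..<a + card S}"
proof (cases "S = {}")
  case False
  have "S = {Min S..Max S}"
  proof (intro equalityI subsetI)
    fix j assume "j \<in> {Min S..Max S}"
    then show "j \<in> S"
      using conv[of "Min S" "Max S" j] Min_in[OF assms(1) False] Max_in[OF assms(1) False]
      by (metis atLeastAtMost_iff le_neq_implies_less)
  qed (use assms(1) in auto)
  moreover have "Min S \<le> Max S" using False assms(1) by simp
  ultimately have "S = {Min S..<Min S + card S}"
    by (metis atLeastLessThanSuc_atLeastAtMost card_atLeastAtMost le_add_diff_inverse le_SucI)
  then show ?thesis by blast
qed simp

text \<open>Layer-cake argument: \<open>h k\<close> counts the thresholds \<open>t\<close> in
  \<open>{1..G}\<close> with \<open>t \<le> h k\<close>, so the weighted sum is a sum over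
  \<open>t\<close> of sums of \<open>\<phi>\<close> over \<open>S t\<close>. Without valleys
  \<open>S t\<close> is an interval; it has at most \<open>v\<close> elements, and monotonicity of
  \<open>f\<close> gives \<open>f v\<close> for each of the \<open>G\<close> thresholds.\<close>

lemma unimodal_weighted_sum_le:
  fixes h :: "nat \<Rightarrow> nat" and \<phi> f :: "nat \<Rightarrow> real"
  assumes uni: "unimodal (\<lambda>k. real (h k))"
    and fin: "finite {k. h k \<noteq> 0}"
    and v: "card {k. h k \<noteq> 0} \<le> v"
    and G: "\<And>k. h k \<le> G"
    and f: "mono f" "\<And>a L. \<bar>\<Sum>k\<in>{a..<a + L}. \<phi> k\<bar> \<le> f L"
  shows "\<bar>\<Sum>k\<in>{k. h k \<noteq> 0}. real (h k) * \<phi> k\<bar> \<le> real G * f v"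
proof -
  define S where "S t = {k. t \<le> h k}" for t
  \<comment> \<open>Thresholds start at 1: \<open>S 0\<close> would be all of the naturals.\<close>
  have sub: "S t \<subseteq> {k. h k \<noteq> 0}" if "t \<ge> 1" for t using that unfolding S_def by auto
  have level: "\<bar>\<Sum>k\<in>S t. \<phi> k\<bar> \<le> f v" if t: "t \<ge> 1" for t
  proof -
    have "finite (S t)" using sub[OF t] fin finite_subset by blast
    moreover have "j \<in> S t" if "i \<in> S t" "l \<in> S t" "i < j" "j < l" for i j l
      using unimodal_no_valley[OF uni fin that(3,4)] that unfolding S_def by auto
    ultimately obtain a where a: "S t = {a..<a + card (S t)}"
      using finite_convex_nat_set_interval by metis
    have "card (S t) \<le> v" using card_mono[OF fin sub[OF t]] v by simp
    then have "f (card (S t)) \<le> f v" using f(1) by (simp add: monoD)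
    then show ?thesis using f(2)[of a "card (S t)"] a by simp
  qed
  have "real (h k) * \<phi> k = (\<Sum>t\<in>{1..G}. if t \<le> h k then \<phi> k else 0)" for k
  proof -
    have "{t\<in>{1..G}. t \<le> h k} = {1..h k}" using G[of k] by auto
    then show ?thesis by (simp add: sum.inter_filter[symmetric])
  qed
  then have "(\<Sum>k\<in>{k. h k \<noteq> 0}. real (h k) * \<phi> k)
      = (\<Sum>t\<in>{1..G}. \<Sum>k\<in>{k. h k \<noteq> 0}. if t \<le> h k then \<phi> k else 0)"
    using sum.swap by simp
  also have "\<dots> = (\<Sum>t\<in>{1..G}. \<Sum>k\<in>S t. \<phi> k)"
  proof (rule sum.cong)
    fix t assume "t \<in> {1..G}"
    then have "S t = {k \<in> {k. h k \<noteq> 0}. t \<le> h k}" unfolding S_def by auto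
    then show "(\<Sum>k\<in>{k. h k \<noteq> 0}. if t \<le> h k then \<phi> k else 0) = (\<Sum>k\<in>S t. \<phi> k)"
      by (simp only: sum.inter_filter[OF fin])
  qed simp
  also have "\<bar>\<dots>\<bar> \<le> (\<Sum>t\<in>{1..G}. f v)"
    by (rule order_trans[OF sum_abs sum_mono]) (use level in auto)
  finally show ?thesis by simp
qed

section \<open>Expansion along the divisibility chain\<close>

text \<open>Induction on \<open>d\<close>: peel off the full blocks of length \<open>Ns d\<close>
  and treat the remainder one level lower. The remainder starts at another multiple of
  \<open>Ns d\<close>, hence the generality in \<open>A\<close>.\<close>

lemma sum_chain_decomposition_le:
  fixes Ns :: "nat \<Rightarrow> nat" and \<psi> c :: "nat \<Rightarrow> real"
  assumes Ns: "Ns 0 = 1" "\<And>j. Ns j dvd Ns (j + 1)" "\<And>j. Ns j > 0"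
    and c: "\<And>j. c j \<ge> 0"
    and block: "\<And>A j. \<bar>\<Sum>n\<in>{A * Ns j..<(A + 1) * Ns j}. \<psi> n\<bar> \<le> c j"
    and "M < Ns d"
  shows "\<bar>\<Sum>n\<in>{A * Ns d..<A * Ns d + M}. \<psi> n\<bar> \<le> (\<Sum>j<d. real (Ns (j + 1)) / real (Ns j) * c j)"
  using \<open>M < Ns d\<close>
proof (induction d arbitrary: A M)
  case 0
  then show ?case using Ns(1) by simp
next
  case (Suc d)
  obtain q where q: "Ns (Suc d) = Ns d * q" using Ns(2)[of d] by auto
  \<comment> \<open>\<open>b\<close> is the digit of \<open>M\<close> at level \<open>d\<close>; it
    stays below the ratio \<open>q\<close> of consecutive chain members.\<close>
  define b r where "b = M div Ns d" and "r = M mod Ns d"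
  have M: "M = b * Ns d + r" unfolding b_def r_def by simp
  have r: "r < Ns d" unfolding r_def using Ns(3) by simp
  have "b < q" using Suc.prems unfolding q b_def
    by (simp add: less_mult_imp_div_less mult.commute)
  have blocks: "\<bar>\<Sum>n\<in>{B * Ns d..<B * Ns d + b * Ns d}. \<psi> n\<bar> \<le> real b * c d" for B b
  proof (induction b)
    case (Suc b)
    have "{B * Ns d..<B * Ns d + Suc b * Ns d}
        = {B * Ns d..<B * Ns d + b * Ns d} \<union> {(B + b) * Ns d..<(B + b + 1) * Ns d}"
      by (auto simp: algebra_simps)
    then have "(\<Sum>n\<in>{B * Ns d..<B * Ns d + Suc b * Ns d}. \<psi> n)
        = (\<Sum>n\<in>{B * Ns d..<B * Ns d + b * Ns d}. \<psi> n)
          + (\<Sum>n\<in>{(B + b) * Ns d..<(B + b + 1) * Ns d}. \<psi> n)"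
      by (simp only:) (rule sum.union_disjoint, auto simp: algebra_simps)
    then show ?case using Suc block[where A="B + b" and j=d] by (simp add: algebra_simps)
  qed simp
  let ?s = "A * Ns (Suc d)"
  \<comment> \<open>Both starting points are multiples of \<open>Ns d\<close>: the first aligns the
    full blocks, the second lets the induction hypothesis apply to the remainder.\<close>
  have s: "?s = (A * q) * Ns d" "?s + b * Ns d = (A * q + b) * Ns d"
    unfolding q by (simp_all add: algebra_simps)
  have "{?s..<?s + M} = {?s..<?s + b * Ns d} \<union> {?s + b * Ns d..<?s + b * Ns d + r}"
    unfolding M by auto
  then have "(\<Sum>n\<in>{?s..<?s + M}. \<psi> n)
      = (\<Sum>n\<in>{?s..<?s + b * Ns d}. \<psi> n) + (\<Sum>n\<in>{?s + b * Ns d..<?s + b * Ns d + r}. \<psi> n)"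
    by (simp only:) (rule sum.union_disjoint, auto)
  moreover have "\<bar>\<Sum>n\<in>{?s..<?s + b * Ns d}. \<psi> n\<bar> \<le> real b * c d"
    unfolding s(1) by (rule blocks)
  moreover have "\<bar>\<Sum>n\<in>{?s + b * Ns d..<?s + b * Ns d + r}. \<psi> n\<bar>
      \<le> (\<Sum>j<d. real (Ns (j + 1)) / real (Ns j) * c j)"
    unfolding s(2) by (rule Suc.IH[OF r])
  moreover have "real b * c d \<le> real (Ns (d + 1)) / real (Ns d) * c d"
    using \<open>b < q\<close> q Ns(3)[of d] c[of d] by (intro mult_right_mono) auto
  ultimately show ?case by simp
qed

section \<open>Volumes of boxes and local discrepancy\<close>

lemma half_open_box_measurable: "half_open_box a (b :: real ^ 's) \<in> sets lborel"
proof -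
  have "half_open_box a b = (\<Inter>i. {y. a $ i \<le> y $ i} \<inter> {y. y $ i < b $ i})"
    unfolding half_open_box_def by auto
  also have "\<dots> \<in> sets borel"
    by (intro sets.countable_INT' sets.Int borel_closed[OF closed_halfspace_component_ge_cart]
        borel_open[OF open_halfspace_component_lt_cart] image_subsetI) auto
  finally show ?thesis by simp
qed

text \<open>Volumes are estimated only from above, so comparison with a closed box, whose content is
  a product, suffices.\<close>

lemma measure_half_open_box_le:
  fixes a b :: "real ^ 's"
  assumes "half_open_box a b \<subseteq> cbox u w"
  shows "measure lborel (half_open_box a b) \<le> measure lborel (cbox u w)"
  by (rule measure_mono_fmeasurable[OF assms half_open_box_measurable]) (rule fmeasurable_cbox)

lemma measure_unit_subbox_le_1:
  fixes a b :: "real ^ 's"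
  assumes "half_open_box a b \<subseteq> half_open_box 0 1"
  shows "measure lborel (half_open_box a b) \<le> 1"
proof -
  have "half_open_box 0 (1 :: real ^ 's) \<subseteq> cbox 0 1"
    unfolding half_open_box_def by (auto simp: mem_box_cart less_imp_le)
  then have "measure lborel (half_open_box a b) \<le> measure lborel (cbox 0 (1 :: real ^ 's))"
    using assms by (intro measure_half_open_box_le) blast
  also have "\<dots> = 1" by (subst content_cbox_cart) (auto simp: interval_eq_empty_cart)
  finally show ?thesis .
qed

text \<open>Relative frequency and volume both lie in [0,1]. This bound makes the suprema over boxes
  and over shifts genuine upper bounds.\<close>

lemma local_discrepancy_le_1:
  fixes a b :: "real ^ 's"
  assumes "half_open_box a b \<subseteq> half_open_box 0 1"
  shows "\<bar>real (card {n. n < N \<and> y n \<in> half_open_box a b}) / real N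
          - measure lborel (half_open_box a b)\<bar> \<le> 1"
proof -
  have "card {n. n < N \<and> y n \<in> half_open_box a b} \<le> card {..<N}" by (rule card_mono) auto
  then have "real (card {n. n < N \<and> y n \<in> half_open_box a b}) / real N \<le> 1"
    by (auto simp: divide_le_eq_1)
  moreover have "real (card {n. n < N \<and> y n \<in> half_open_box a b}) / real N \<ge> 0" by simp
  moreover have "measure lborel (half_open_box a b) \<ge> 0" by simp
  ultimately show ?thesis using measure_unit_subbox_le_1[OF assms] by linarith
qed

lemma local_le_discrepancy:
  assumes "half_open_box a b \<subseteq> half_open_box 0 1"
  shows "\<bar>real (card {n. n < N \<and> y n \<in> half_open_box a b}) / real N
          - measure lborel (half_open_box a b)\<bar> \<le> discrepancy N y"
  unfolding discrepancy_def
proof (rule cSUP_upper2[where x="(a, b)"])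
  show "bdd_above ((\<lambda>(a, b). \<bar>real (card {n. n < N \<and> y n \<in> half_open_box a b}) / real N
          - measure lborel (half_open_box a b)\<bar>) ` {(a, b). half_open_box a b \<subseteq> half_open_box 0 1})"
    by (rule bdd_aboveI[where M=1]) (auto intro: local_discrepancy_le_1)
qed (use assms in auto)

lemma discrepancy_le:
  assumes "\<And>a b. half_open_box a b \<subseteq> half_open_box 0 1 \<Longrightarrow>
      \<bar>real (card {n. n < N \<and> y n \<in> half_open_box a b}) / real N
          - measure lborel (half_open_box a b)\<bar> \<le> C"
  shows "discrepancy N y \<le> C"
  unfolding discrepancy_def by (rule cSUP_least) (use assms in auto)

lemma discrepancy_le_uniform: "discrepancy N (\<lambda>n. x (n + k)) \<le> uniform_discrepancy N x"
  unfolding uniform_discrepancy_def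
  by (rule cSUP_upper) (auto intro!: bdd_aboveI[where M=1] discrepancy_le local_discrepancy_le_1)

lemma sum_indicator_minus_const:
  "(\<Sum>n<N. (if P n then 1 else 0) - c) = real (card {n. n < N \<and> P n}) - real N * (c :: real)"
proof -
  have "(\<Sum>n<N. if P n then 1 else 0 :: real) = real (card {n \<in> {..<N}. P n})"
    by (simp add: sum.inter_filter[symmetric])
  then show ?thesis by (simp add: sum_subtractf)
qed

text \<open>For \<open>L > 0\<close> the sum over a window starting at \<open>m\<close> is
  \<open>L\<close> times the signed local discrepancy of the sequence shifted by \<open>m\<close>;
  the supremum over shifts makes the bound independent of \<open>m\<close>.\<close>

lemma interval_sum_le_uniform_discrepancy:
  fixes x :: "nat \<Rightarrow> real ^ 's"
  assumes "half_open_box a b \<subseteq> half_open_box 0 1"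
  shows "\<bar>\<Sum>k\<in>{m..<m + L}. (if x k \<in> half_open_box a b then 1 else 0)
            - measure lborel (half_open_box a b)\<bar> \<le> real L * uniform_discrepancy L x"
    (is "\<bar>?s\<bar> \<le> _")
proof (cases "L = 0")
  case False
  let ?c = "real (card {n. n < L \<and> x (n + m) \<in> half_open_box a b})"
  have "?s = (\<Sum>n<L. (if x (n + m) \<in> half_open_box a b then 1 else 0) - measure lborel (half_open_box a b))"
    using sum.shift_bounds_nat_ivl[of _ 0 m L] by (simp add: add.commute atLeast0LessThan)
  also have "\<dots> = ?c - real L * measure lborel (half_open_box a b)"
    by (rule sum_indicator_minus_const)
  also have "\<dots> = real L * (?c / real L - measure lborel (half_open_box a b))"
    using False by (simp add: field_simps)
  finally have "\<bar>?s\<bar> = real L * \<bar>?c / real L - measure lborel (half_open_box a b)\<bar>"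
    by (simp add: abs_mult)
  also have "\<dots> \<le> real L * uniform_discrepancy L x"
    using local_le_discrepancy[OF assms] discrepancy_le_uniform order_trans
    by (intro mult_left_mono) (blast, simp)
  finally show ?thesis .
qed simp

section \<open>Small boxes and the lower bound\<close>

text \<open>A box with lower corner \<open>x k\<close> contains \<open>x (g n)\<close> for the whole
  fiber \<open>g n = k\<close>. Its volume costs at most \<open>e\<close> after scaling by
  \<open>N\<close>, and \<open>e\<close> is arbitrary.\<close>

lemma card_fiber_le_discrepancy:
  fixes x :: "nat \<Rightarrow> real ^ 's"
  assumes x: "x k \<in> half_open_box 0 1" and N: "N \<ge> 1"
  shows "real (card {n. n < N \<and> g n = k}) \<le> real N * discrepancy N (\<lambda>n. x (g n))"
proof (rule field_le_epsilon)
  fix e :: real assume e: "e > 0"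
  \<comment> \<open>The side length is at most 1 so that its powers do not exceed it, at most
    \<open>e / real N\<close> to make the volume negligible, and at most each
    \<open>1 - x k $ i\<close> to keep the box in the unit cube.\<close>
  define u where "u = Min (insert 1 (insert (e / real N) (range (\<lambda>i. 1 - x k $ i))))"
  have fin: "finite (insert 1 (insert (e / real N) (range (\<lambda>i. 1 - x k $ i))))" by simp
  have "u \<in> insert 1 (insert (e / real N) (range (\<lambda>i. 1 - x k $ i)))"
    unfolding u_def by (rule Min_in) auto
  then have "u > 0" using e N x by (auto simp: half_open_box_def)
  have u: "u \<le> 1" "u \<le> e / real N" "u \<le> 1 - x k $ i" for i
    unfolding u_def by (rule Min_le[OF fin]; simp)+
  define B where "B = half_open_box (x k) (x k + vec u)"
  have sub: "B \<subseteq> half_open_box 0 1"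
  proof
    fix y assume "y \<in> B"
    then have "x k $ i \<le> y $ i" "y $ i < x k $ i + u" for i
      unfolding B_def half_open_box_def by auto
    moreover have "0 \<le> x k $ i" for i using x unfolding half_open_box_def by auto
    ultimately have "0 \<le> y $ i" "y $ i < 1" for i using u(3)[of i]
      by (metis order_trans, metis add.commute le_diff_eq less_le_trans)
    then show "y \<in> half_open_box 0 1" unfolding half_open_box_def by simp
  qed
  have "measure lborel B \<le> measure lborel (cbox (x k) (x k + vec u))"
    unfolding B_def by (rule measure_half_open_box_le) (auto simp: half_open_box_def mem_box_cart less_imp_le)
  also have "\<dots> = u ^ CARD('s)"
    using \<open>u > 0\<close> by (subst content_cbox_cart) (auto simp: interval_eq_empty_cart not_less)
  also have "\<dots> \<le> u" using \<open>u > 0\<close> u(1) power_decreasing[of 1 "CARD('s)" u] by simp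
  finally have vol: "real N * measure lborel B \<le> e"
    using mult_left_mono[of "measure lborel B" "e / real N" "real N"] u(2) N by simp
  let ?c = "real (card {n. n < N \<and> x (g n) \<in> B})"
  have "x k \<in> B" using \<open>u > 0\<close> unfolding B_def half_open_box_def by simp
  then have "card {n. n < N \<and> g n = k} \<le> card {n. n < N \<and> x (g n) \<in> B}"
    by (intro card_mono) auto
  then have "real (card {n. n < N \<and> g n = k}) \<le> real N * (?c / real N - measure lborel B) + real N * measure lborel B"
    using N by (simp add: field_simps)
  also have "real N * (?c / real N - measure lborel B) \<le> real N * discrepancy N (\<lambda>n. x (g n))"
    using local_le_discrepancy[of "x k" "x k + vec u" N "\<lambda>n. x (g n)"] sub unfolding B_def
    by (intro mult_left_mono) auto
  finally show "real (card {n. n < N \<and> g n = k}) \<le> real N * discrepancy N (\<lambda>n. x (g n)) + e"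
    using vol by simp
qed

section \<open>Values of \<open>g\<close> on blocks\<close>

lemma block_card_le: "card {n. A * M \<le> n \<and> n < (A + 1) * M \<and> P n} \<le> (M :: nat)"
proof -
  have "card {n. A * M \<le> n \<and> n < (A + 1) * M \<and> P n} \<le> card {A * M..<(A + 1) * M}"
    by (rule card_mono) auto
  then show ?thesis by simp
qed

lemma hits_le: "hits Ns g A j k \<le> Ns j"
  unfolding hits_def by (rule block_card_le)

text \<open>Although \<open>A\<close> and \<open>k\<close> range over all naturals, the counts are
  at most \<open>Ns j\<close>; the set is finite and \<open>Max\<close> is a true maximum.\<close>

lemma hits_le_max_hits: "hits Ns g A j k \<le> max_hits Ns g j"
proof -
  have "finite {hits Ns g A j k | A k. True}"
    by (rule finite_subset[of _ "{..Ns j}"]) (auto simp: hits_le)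
  then show ?thesis unfolding max_hits_def by (rule Max_ge) auto
qed

lemma num_values_eq: "num_values Ns g A j = card (g ` {A * Ns j..<(A + 1) * Ns j})"
  unfolding num_values_def by (rule arg_cong[where f=card]) (auto simp: image_iff)

lemma num_values_le_max: "num_values Ns g A j \<le> max_num_values Ns g j"
proof -
  have le: "num_values Ns g A j \<le> Ns j" for A
    unfolding num_values_eq using card_image_le[of "{A * Ns j..<(A + 1) * Ns j}" g] by simp
  have "finite {num_values Ns g A j | A. True}"
    by (rule finite_subset[of _ "{..Ns j}"]) (auto simp: le)
  then show ?thesis unfolding max_num_values_def by (rule Max_ge) auto
qed

text \<open>Identifies the support as a finite set whose cardinality is
  \<open>num_values\<close>.\<close>

lemma hits_support: "{k. hits Ns g A j k \<noteq> 0} = g ` {A * Ns j..<(A + 1) * Ns j}"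
proof -
  have "finite {n. A * Ns j \<le> n \<and> n < (A + 1) * Ns j \<and> g n = k}" for k
    by (rule finite_subset[of _ "{..<(A + 1) * Ns j}"]) auto
  then show ?thesis unfolding hits_def by (auto simp: image_iff)
qed

text \<open>Group the indices of the block by their value under \<open>g\<close>.\<close>

lemma block_sum_eq_hits:
  fixes \<phi> :: "nat \<Rightarrow> real"
  shows "(\<Sum>n\<in>{A * Ns j..<(A + 1) * Ns j}. \<phi> (g n))
    = (\<Sum>k\<in>{k. hits Ns g A j k \<noteq> 0}. real (hits Ns g A j k) * \<phi> k)"
proof -
  let ?I = "{A * Ns j..<(A + 1) * Ns j}"
  have "(\<Sum>n\<in>?I. \<phi> (g n)) = (\<Sum>k\<in>g ` ?I. \<Sum>n\<in>{n \<in> ?I. g n = k}. \<phi> (g n))"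
    by (rule sum.image_gen) simp
  also have "\<dots> = (\<Sum>k\<in>g ` ?I. real (hits Ns g A j k) * \<phi> k)"
  proof (rule sum.cong)
    fix k
    have "{n \<in> ?I. g n = k} = {n. A * Ns j \<le> n \<and> n < (A + 1) * Ns j \<and> g n = k}" by auto
    then show "(\<Sum>n\<in>{n \<in> ?I. g n = k}. \<phi> (g n)) = real (hits Ns g A j k) * \<phi> k"
      unfolding hits_def by simp
  qed simp
  finally show ?thesis unfolding hits_support .
qed

lemma block_sum_le:
  fixes \<phi> f :: "nat \<Rightarrow> real"
  assumes "unimodal (\<lambda>k. real (hits Ns g A j k))"
    and "mono f" "\<And>a L. \<bar>\<Sum>k\<in>{a..<a + L}. \<phi> k\<bar> \<le> f L"
  shows "\<bar>\<Sum>n\<in>{A * Ns j..<(A + 1) * Ns j}. \<phi> (g n)\<bar>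
    \<le> real (max_hits Ns g j) * f (max_num_values Ns g j)"
  unfolding block_sum_eq_hits
proof (rule unimodal_weighted_sum_le)
  show "card {k. hits Ns g A j k \<noteq> 0} \<le> max_num_values Ns g j"
    unfolding hits_support using num_values_le_max[of Ns g A j] by (simp add: num_values_eq)
  show "finite {k. hits Ns g A j k \<noteq> 0}" unfolding hits_support by simp
qed (use assms hits_le_max_hits in auto)

section \<open>Lower and upper bounds for the sequence indexed by \<open>g\<close>\<close>

theorem theorem1:
  fixes x :: "nat \<Rightarrow> real ^ 's"
    and f :: "nat \<Rightarrow> real"
    and g :: "nat \<Rightarrow> nat"
    and Ns :: "nat \<Rightarrow> nat"
  assumes "\<And>n. x n \<in> half_open_box 0 1"
    and "mono f"
    and "\<And>N. real N * uniform_discrepancy N x \<le> f N"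
    and "strict_mono Ns"
    and "Ns 0 = 1"
    and "\<And>j. Ns j dvd Ns (j + 1)"
  shows "(\<forall>N d. N \<ge> 1 \<and> Ns d \<le> N \<and> N < Ns (d + 1) \<longrightarrow>
            real N * discrepancy N (\<lambda>n. x (g n)) \<ge> real (Max {hits Ns g 0 d k | k. True}))
       \<and> ((\<forall>j A. unimodal (\<lambda>k. real (hits Ns g A j k))) \<longrightarrow>
            (\<forall>N d. N \<ge> 1 \<and> Ns d \<le> N \<and> N < Ns (d + 1) \<longrightarrow>
               real N * discrepancy N (\<lambda>n. x (g n))
                 \<le> (\<Sum>j = 0..d. real (Ns (j + 1)) / real (Ns j)
                        * real (max_hits Ns g j) * f (max_num_values Ns g j))))"
proof (intro conjI allI impI)
  fix N d
  assume N: "N \<ge> 1 \<and> Ns d \<le> N \<and> N < Ns (d + 1)"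
  have "Max {hits Ns g 0 d k | k. True} \<in> {hits Ns g 0 d k | k. True}"
  proof (rule Max_in)
    show "finite {hits Ns g 0 d k | k. True}"
      by (rule finite_subset[of _ "{..Ns d}"]) (auto simp: hits_le)
  qed auto
  then obtain k where k: "Max {hits Ns g 0 d k | k. True} = hits Ns g 0 d k" by auto
  \<comment> \<open>The block with \<open>A = 0\<close> is \<open>[0, Ns d)\<close>, which lies in
    \<open>[0, N)\<close>.\<close>
  have "hits Ns g 0 d k \<le> card {n. n < N \<and> g n = k}"
    unfolding hits_def by (rule card_mono) (use N in auto)
  then show "real (Max {hits Ns g 0 d k | k. True}) \<le> real N * discrepancy N (\<lambda>n. x (g n))"
    using card_fiber_le_discrepancy[where x=x and k=k and g=g and N=N, OF assms(1)] N
    unfolding k by linarith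
next
  fix N d
  assume uni: "\<forall>j A. unimodal (\<lambda>k. real (hits Ns g A j k))"
    and N: "N \<ge> 1 \<and> Ns d \<le> N \<and> N < Ns (d + 1)"
  let ?c = "\<lambda>j. real (max_hits Ns g j) * f (max_num_values Ns g j)"
  let ?R = "\<Sum>j = 0..d. real (Ns (j + 1)) / real (Ns j) * real (max_hits Ns g j) * f (max_num_values Ns g j)"
  have N_pos: "0 < real N" using N by simp
  have Ns_pos: "Ns j > 0" for j
    using strict_mono_leD[OF assms(4), of 0 j] assms(5) by simp
  have "discrepancy N (\<lambda>n. x (g n)) \<le> ?R / real N"
  proof (rule discrepancy_le)
    fix a b :: "real ^ 's"
    assume sub: "half_open_box a b \<subseteq> half_open_box 0 1"
    let ?v = "measure lborel (half_open_box a b)"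
    define \<phi> where "\<phi> k = (if x k \<in> half_open_box a b then 1 else 0) - ?v" for k
    have \<phi>: "\<bar>\<Sum>k\<in>{m..<m + L}. \<phi> k\<bar> \<le> f L" for m L
      using interval_sum_le_uniform_discrepancy[OF sub, where m=m and L=L and x=x] assms(3)[of L]
      unfolding \<phi>_def by linarith
    \<comment> \<open>\<open>f L\<close> dominates an absolute value; this makes the block bounds
      \<open>?c j\<close> nonnegative.\<close>
    have f_nonneg: "f L \<ge> 0" for L using \<phi>[of 0 L] by linarith
    \<comment> \<open>Since \<open>N < Ns (d + 1)\<close>, the expansion is applied at level
      \<open>d + 1\<close> with \<open>A = 0\<close>, so the levels used are exactly 0 to
      \<open>d\<close>.\<close>
    have "\<bar>\<Sum>n\<in>{0 * Ns (d + 1)..<0 * Ns (d + 1) + N}. \<phi> (g n)\<bar>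
        \<le> (\<Sum>j<d + 1. real (Ns (j + 1)) / real (Ns j) * ?c j)"
      by (rule sum_chain_decomposition_le)
        (use assms(5,6) Ns_pos f_nonneg N block_sum_le[OF _ assms(2) \<phi>] uni in auto)
    also have "\<dots> = ?R"
      by (simp add: lessThan_Suc_atMost atLeast0AtMost mult.assoc)
    also have "(\<Sum>n\<in>{0 * Ns (d + 1)..<0 * Ns (d + 1) + N}. \<phi> (g n))
        = real (card {n. n < N \<and> x (g n) \<in> half_open_box a b}) - real N * ?v"
      unfolding \<phi>_def using sum_indicator_minus_const by (simp add: atLeast0LessThan)
    also have "\<dots> = real N * (real (card {n. n < N \<and> x (g n) \<in> half_open_box a b}) / real N - ?v)"
      using N by (simp add: field_simps)
    finally show "\<bar>real (card {n. n < N \<and> x (g n) \<in> half_open_box a b}) / real N - ?v\<bar> \<le> ?R / real N"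
      by (simp only: abs_mult abs_of_nat pos_le_divide_eq[OF N_pos] mult.commute[of _ "real N"])
  qed
  then show "real N * discrepancy N (\<lambda>n. x (g n)) \<le> ?R"
    by (simp only: pos_le_divide_eq[OF N_pos] mult.commute[of _ "real N"])
qed

end
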